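(* Let $S$ be a dense subsemigroup of $((0,\infty),+)$ such that $cS$ is central$^{*}$ near zero for every $c\in\mathbb{N}$. For each $n\in\mathbb{N}$, let $M_{n}$ be an $\omega\times\omega$ matrix with entries from $\mathbb{Q}$ that is centrally image partition regular near zero over $S$. Then the block diagonal matrix $$M=\begin{pmatrix} M_{1}&0&0&\cdots\\ 0&M_{2}&0&\cdots\\ 0&0&M_{3}&\cdots\\ \vdots&\vdots&\vdots&\ddots\end{pmatrix}$$ is also centrally image partition regular near zero over $S$.
   Context: $\omega=\{0,1,2,\ldots\}$, $\mathbb{N}=\{1,2,3,\ldots\}$. "Dense" means dense in $(0,\infty)$ with the usual topology. All matrices have only finitely many nonzero entries in each row, so that $A\vec x$ is defined. The rows and columns of $M$ are indexed by the countably infinite set $\mathbb{N}\times\omega$ (which may be identified with $\omega$). Let $\beta S_d$ be the Stone-Čech compactification of $S$ with the discrete topology, viewed as the set of ultrafilters on $S$, with the operation given by $B\in p+q$ iff $\{x\in S: -x+B\in q\}\in p$, where $-x+B=\{y\in S: x+y\in B\}$. Let $0^{+}(S)=\{p\in\beta S_d: (0,\epsilon)\cap S\in p \text{ for all } \epsilon>0\}$, a compact right topological subsemigroup of $\beta S_d$. A minimal idempotent of $0^{+}(S)$ is an idempotent in the smallest two-sided ideal of $0^{+}(S)$. A set $C\subseteq S$ is central near zero if $C\in p$ for some minimal idempotent $p$ of $0^{+}(S)$, and is central$^{*}$ near zero if $C\in p$ for every minimal idempotent $p$ of $0^{+}(S)$. A matrix $A$ with rational entries and rows and columns indexed by countably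 infinite sets $I$ and $J$ is centrally image partition regular near zero over $S$ if for every $C\subseteq S$ that is central near zero there is $\vec x\in S^{J}$ with $A\vec x\in C^{I}$. *)

theory Defs
  imports "HOL-Analysis.Analysis"
begin

definition dense_subsemigroup :: "real set \<Rightarrow> bool" where
  "dense_subsemigroup S \<longleftrightarrow>
     S \<subseteq> {0<..} \<and> (\<forall>x\<in>S. \<forall>y\<in>S. x + y \<in> S) \<and> {0<..} \<subseteq> closure S"

text \<open>
  The points of \<open>\<beta>S\<^sub>d\<close> are the ultrafilters on the set \<open>S\<close>, represented as
  families of subsets of \<open>S\<close> (not of the whole type).
\<close>

definition ultrafilters_on :: "'a set \<Rightarrow> 'a set set set" where
  "ultrafilters_on S = {p. p \<subseteq> Pow S \<and> S \<in> p \<and> {} \<notin> p \<and>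
     (\<forall>A\<in>p. \<forall>B\<in>p. A \<inter> B \<in> p) \<and>
     (\<forall>A\<in>p. \<forall>B. A \<subseteq> B \<and> B \<subseteq> S \<longrightarrow> B \<in> p) \<and>
     (\<forall>A. A \<subseteq> S \<longrightarrow> A \<in> p \<or> S - A \<in> p)}"

definition uf_plus :: "real set \<Rightarrow> real set set \<Rightarrow> real set set \<Rightarrow> real set set" where
  "uf_plus S p q = {B. B \<subseteq> S \<and> {x \<in> S. {y \<in> S. x + y \<in> B} \<in> q} \<in> p}"

definition zero_plus :: "real set \<Rightarrow> real set set set" where
  "zero_plus S = {p \<in> ultrafilters_on S. \<forall>\<epsilon>>0. {0<..<\<epsilon>} \<inter> S \<in> p}"

definition two_sided_ideal :: "('a \<Rightarrow> 'a \<Rightarrow> 'a) \<Rightarrow> 'a set \<Rightarrow> 'a set \<Rightarrow> bool" where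
  "two_sided_ideal f T I \<longleftrightarrow>
     I \<noteq> {} \<and> I \<subseteq> T \<and> (\<forall>t\<in>T. \<forall>i\<in>I. f t i \<in> I \<and> f i t \<in> I)"

text \<open>
  The operator \<open>LEAST\<close> below refers to inclusion of sets.  A smallest two-sided
  ideal exists in every compact right topological semigroup, in particular in
  \<open>zero_plus S\<close> for a dense subsemigroup \<open>S\<close>.
\<close>

definition smallest_ideal :: "('a \<Rightarrow> 'a \<Rightarrow> 'a) \<Rightarrow> 'a set \<Rightarrow> 'a set" where
  "smallest_ideal f T = (LEAST I. two_sided_ideal f T I)"

definition minimal_idempotent :: "real set \<Rightarrow> real set set \<Rightarrow> bool" where
  "minimal_idempotent S p \<longleftrightarrow>
     p \<in> smallest_ideal (uf_plus S) (zero_plus S) \<and> uf_plus S p p = p"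

definition central_near_zero :: "real set \<Rightarrow> real set \<Rightarrow> bool" where
  "central_near_zero S C \<longleftrightarrow> C \<subseteq> S \<and> (\<exists>p. minimal_idempotent S p \<and> C \<in> p)"

definition central_star_near_zero :: "real set \<Rightarrow> real set \<Rightarrow> bool" where
  "central_star_near_zero S C \<longleftrightarrow> C \<subseteq> S \<and> (\<forall>p. minimal_idempotent S p \<longrightarrow> C \<in> p)"

text \<open>
  A matrix is a function of a row and a column index; only its values on
  \<open>I \<times> J\<close> matter.
\<close>

definition admissible_matrix :: "'i set \<Rightarrow> 'j set \<Rightarrow> ('i \<Rightarrow> 'j \<Rightarrow> rat) \<Rightarrow> bool" where
  "admissible_matrix I J A \<longleftrightarrow>
     countable I \<and> infinite I \<and> countable J \<and> infinite J \<and>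
     (\<forall>i\<in>I. finite {j \<in> J. A i j \<noteq> 0})"

definition mat_apply :: "'j set \<Rightarrow> ('i \<Rightarrow> 'j \<Rightarrow> rat) \<Rightarrow> ('j \<Rightarrow> real) \<Rightarrow> 'i \<Rightarrow> real" where
  "mat_apply J A x i = (\<Sum>j\<in>{j \<in> J. A i j \<noteq> 0}. of_rat (A i j) * x j)"

definition centrally_ipr_near_zero ::
    "real set \<Rightarrow> 'i set \<Rightarrow> 'j set \<Rightarrow> ('i \<Rightarrow> 'j \<Rightarrow> rat) \<Rightarrow> bool" where
  "centrally_ipr_near_zero S I J A \<longleftrightarrow>
     admissible_matrix I J A \<and>
     (\<forall>C. central_near_zero S C \<longrightarrow>
        (\<exists>x. (\<forall>j\<in>J. x j \<in> S) \<and> (\<forall>i\<in>I. mat_apply J A x i \<in> C)))"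

definition block_diagonal ::
    "('n \<Rightarrow> 'i \<Rightarrow> 'j \<Rightarrow> rat) \<Rightarrow> 'n \<times> 'i \<Rightarrow> 'n \<times> 'j \<Rightarrow> rat" where
  "block_diagonal M = (\<lambda>(m, i) (n, j). if m = n then M m i j else 0)"

end

theory Submission
  imports Defs
begin

text \<open>
  Image partition regularity asks for a solution \<open>x\<close> depending on a given set \<open>C\<close>, and
  the very same \<open>C\<close> may be handed to every block.  A row \<open>(n, i)\<close> of the block
  diagonal matrix sees only the variables \<open>(n, j)\<close>, so solutions chosen independently
  for the blocks place no conditions on each other, and their concatenation solves the
  whole system.
\<close>

text \<open>
  The nonzero entries of a row of the block diagonal matrix form a copy of the nonzero
  entries of the corresponding row of the block.  Both admissibility of the block diagonal
  matrix and its action on vectors follow from this.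
\<close>
lemma block_diagonal_row_support:
  assumes "n \<in> N"
  shows "{k \<in> N \<times> J. block_diagonal M (n, i) k \<noteq> 0} = Pair n ` {j \<in> J. M n i j \<noteq> 0}"
  using assms by (auto simp: block_diagonal_def split: if_splits)

lemma mat_apply_block_diagonal:
  assumes "n \<in> N"
  shows "mat_apply (N \<times> J) (block_diagonal M) x (n, i) = mat_apply J (M n) (\<lambda>j. x (n, j)) i"
proof -
  have "inj_on (Pair n) {j \<in> J. M n i j \<noteq> 0}"
    by (simp add: inj_on_def)
  then show ?thesis
    unfolding mat_apply_def block_diagonal_row_support[OF assms]
    by (simp add: sum.reindex block_diagonal_def)
qed

lemma admissible_block_diagonal:
  assumes "countable N" and "N \<noteq> {}" and "\<And>n. n \<in> N \<Longrightarrow> admissible_matrix I J (M n)"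
  shows "admissible_matrix (N \<times> I) (N \<times> J) (block_diagonal M)"
proof -
  have "finite {k \<in> N \<times> J. block_diagonal M (n, i) k \<noteq> 0}" if "n \<in> N" "i \<in> I" for n i
    unfolding block_diagonal_row_support[OF that(1)]
    using assms(3)[OF that(1)] that(2) by (simp add: admissible_matrix_def)
  moreover have "countable I" "infinite I" "countable J" "infinite J"
    using assms(2,3) by (auto simp: admissible_matrix_def)
  ultimately show ?thesis
    using assms(1,2) by (auto simp: admissible_matrix_def finite_cartesian_product_iff)
qed

lemma centrally_ipr_near_zero_block_diagonal:
  assumes "countable N" and "N \<noteq> {}"
    and blocks: "\<And>n. n \<in> N \<Longrightarrow> centrally_ipr_near_zero S I J (M n)"
  shows "centrally_ipr_near_zero S (N \<times> I) (N \<times> J) (block_diagonal M)"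
  unfolding centrally_ipr_near_zero_def
proof (intro conjI allI impI)
  show "admissible_matrix (N \<times> I) (N \<times> J) (block_diagonal M)"
    using assms by (intro admissible_block_diagonal) (auto simp: centrally_ipr_near_zero_def)
next
  fix C assume "central_near_zero S C"
  then have "\<forall>n\<in>N. \<exists>x. (\<forall>j\<in>J. x j \<in> S) \<and> (\<forall>i\<in>I. mat_apply J (M n) x i \<in> C)"
    using blocks by (auto simp: centrally_ipr_near_zero_def)
  then obtain x where x: "\<forall>n\<in>N. (\<forall>j\<in>J. x n j \<in> S) \<and> (\<forall>i\<in>I. mat_apply J (M n) (x n) i \<in> C)"
    by (auto dest: bchoice)
  have "(\<forall>k\<in>N \<times> J. case_prod x k \<in> S) \<and>
    (\<forall>k\<in>N \<times> I. mat_apply (N \<times> J) (block_diagonal M) (case_prod x) k \<in> C)"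
    using x by (auto simp: mat_apply_block_diagonal)
  then show "\<exists>y. (\<forall>k\<in>N \<times> J. y k \<in> S) \<and>
    (\<forall>k\<in>N \<times> I. mat_apply (N \<times> J) (block_diagonal M) y k \<in> C)" by (intro exI[of _ "case_prod x"])
qed

theorem proposition2p6:
  fixes S :: "real set" and M :: "nat \<Rightarrow> nat \<Rightarrow> nat \<Rightarrow> rat"
  assumes "dense_subsemigroup S"
    and "\<And>c::nat. c \<ge> 1 \<Longrightarrow> central_star_near_zero S ((\<lambda>s. real c * s) ` S)"
    and "\<And>n. n \<ge> 1 \<Longrightarrow>
           centrally_ipr_near_zero S (UNIV :: nat set) (UNIV :: nat set) (M n)"
  shows "centrally_ipr_near_zero S ({1..} \<times> (UNIV :: nat set)) ({1..} \<times> (UNIV :: nat set))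
           (block_diagonal M)"
  using assms(3) by (intro centrally_ipr_near_zero_block_diagonal) auto

end
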